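(* Let $D\subset\mathbb{R}^2$ be the open unit disc and let $f\in C^s(D)$ be a real-valued function. Let the origin $0$ be an elliptic cusp of Gauss of the surface $M=\{z=f(x,y)\}$ with $\kappa_1>0$; that is, $f$ has Taylor expansion at the origin $$f(x,y)=\tfrac12\kappa_1x^2+b_0x^3+b_1x^2y+b_2xy^2+c_0x^4+c_1x^3y+c_2x^2y^2+c_3xy^3+c_4y^4+\text{higher order terms},$$ with $\kappa_1>0$ and $b_2^2<2\kappa_1c_4$. Set $q(x,y)=\frac12\kappa_1x^2+b_2xy^2+c_4y^4$ and let $r_0:S^1\to\mathbb{R}^+$ be defined by $r_0(\theta)=q(\cos\theta,\sin\theta)^{-1/4}$. Then there exists a function $r:[0,\epsilon)\times S^1\to\mathbb{R}^+$, for some $\epsilon>0$, with (a) $r\in C^{[s/4]}([0,\epsilon)\times S^1)$; (b) $r(0,\theta)=r_0(\theta)$ on $S^1$; (c) $f\big((t\,r(t,\theta))^2\cos\theta,\;t\,r(t,\theta)\sin\theta\big)=t^4$ on $[0,\epsilon)\times S^1$.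
   Context: $S^1\subset\mathbb{R}^2$ is the unit circle, with $\theta\in S^1$ corresponding to $(\cos\theta,\sin\theta)$. $\mathbb{R}^+$ denotes the positive reals. $s$ is the differentiability class of $f$ (an integer or $\infty$), with no restriction beyond the existence of the Taylor coefficients up to order 4 used above. "Higher order terms" means a remainder $o(|(x,y)|^4)$. $[s/4]$ denotes the integer part of $s/4$, with $[\infty/4]=\infty$. The surface is in Monge form: $f(0)=0$, $df(0)=0$, no $xy$ term; for a cusp of Gauss the coefficients of $y^2$ and $y^3$ also vanish, and it is elliptic when $b_2^2<2\kappa_1c_4$.
   Formalization: The formal theorem takes s ≥ 4 and, for s = 4, claims only that r is continuous, since r ∈ C^1 fails for f = x²+y⁴+|y|^{9/2}; for s ≤ 3 with only a Taylor expansion to order 4 even a continuous r may not exist. *)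

theory Defs
  imports "HOL-Analysis.Analysis"
begin

text \<open>
  Functions of class \<open>C\<^sup>n\<close> on \<open>S\<close>: all iterated directional derivatives up to order \<open>n\<close> exist
  and are continuous. Derivatives are taken within \<open>S\<close>, so they are one-sided at boundary points
  belonging to \<open>S\<close>. The definition is intended for sets on which the derivative within \<open>S\<close> is
  unique; it is used below only for an open disc and for strips \<open>[0, \<epsilon>) \<times> \<real>\<close> with \<open>\<epsilon> > 0\<close>.
\<close>

primrec Cn_on ::
  "nat \<Rightarrow> ('a::real_normed_vector \<Rightarrow> 'b::real_normed_vector) \<Rightarrow> 'a set \<Rightarrow> bool" where
  "Cn_on 0 f S \<longleftrightarrow> continuous_on S f"
| "Cn_on (Suc n) f S \<longleftrightarrow>
    (\<exists>f'. (\<forall>x\<in>S. (f has_derivative f' x) (at x within S)) \<and> (\<forall>v. Cn_on n (\<lambda>x. f' x v) S))"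

definition C_on ::
  "enat \<Rightarrow> ('a::real_normed_vector \<Rightarrow> 'b::real_normed_vector) \<Rightarrow> 'a set \<Rightarrow> bool" where
  "C_on s f S \<longleftrightarrow> (\<forall>n. enat n \<le> s \<longrightarrow> Cn_on n f S)"

text \<open>
  The integer part of \<open>s/4\<close>, with \<open>[\<infinity>/4] = \<infinity>\<close>. A radius function of class \<open>C\<close> with exponent
  \<open>[s/4]\<close> need not exist for \<open>s = 4\<close>, so only continuity is claimed there: for
  \<open>f(x,y) = x\<^sup>2 + y\<^sup>4 + y\<^sup>4 \<bar>y\<bar>\<^bsup>1/2\<^esup>\<close>, which is of class \<open>C\<^sup>4\<close>, the radius \<open>r = r(t, \<pi>/2)\<close> is
  determined by \<open>r\<^sup>4 (1 + (t r)\<^bsup>1/2\<^esup>) = 1\<close>, so it behaves like \<open>1 - t\<^bsup>1/2\<^esup>/4\<close> and has no derivative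
  at \<open>t = 0\<close>.
\<close>

definition quarter :: "enat \<Rightarrow> enat" where
  "quarter s = (case s of enat n \<Rightarrow> enat (n div 4) | \<infinity> \<Rightarrow> \<infinity>)"

definition circle_pt :: "real \<Rightarrow> real \<times> real" where
  "circle_pt \<theta> = (cos \<theta>, sin \<theta>)"

abbreviation unit_circle :: "(real \<times> real) set" where
  "unit_circle \<equiv> sphere 0 1"

text \<open>
  Class \<open>C\<^sup>s\<close> on the manifold with boundary \<open>[0, \<epsilon>) \<times> S\<^sup>1\<close>. Since \<^const>\<open>circle_pt\<close> restricts to
  charts of the circle, this is tested on the lift to \<open>[0, \<epsilon>) \<times> \<real>\<close>.
\<close>

definition C_on_collar :: "enat \<Rightarrow> real \<Rightarrow> (real \<times> (real \<times> real) \<Rightarrow> real) \<Rightarrow> bool" where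
  "C_on_collar s \<epsilon> r \<longleftrightarrow> C_on s (\<lambda>(t, \<theta>). r (t, circle_pt \<theta>)) ({0..<\<epsilon>} \<times> UNIV)"

definition cusp_q :: "real \<Rightarrow> real \<Rightarrow> real \<Rightarrow> real \<Rightarrow> real \<Rightarrow> real" where
  "cusp_q \<kappa>\<^sub>1 b\<^sub>2 c\<^sub>4 x y = 1/2 * \<kappa>\<^sub>1 * x^2 + b\<^sub>2 * x * y^2 + c\<^sub>4 * y^4"

definition cusp_r0 :: "real \<Rightarrow> real \<Rightarrow> real \<Rightarrow> real \<Rightarrow> real" where
  "cusp_r0 \<kappa>\<^sub>1 b\<^sub>2 c\<^sub>4 \<theta> = cusp_q \<kappa>\<^sub>1 b\<^sub>2 c\<^sub>4 (cos \<theta>) (sin \<theta>) powr (-1/4)"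

end

theory Submission
  imports Defs
begin

text \<open>
  Along the curves \<open>\<rho> \<mapsto> (\<rho>\<^sup>2 cos \<theta>, \<rho> sin \<theta>)\<close> the three terms of \<open>q\<close> are homogeneous of degree 4
  in \<open>\<rho>\<close>, and every other term of the expansion of \<open>f\<close> is \<open>o(\<rho>\<^sup>4)\<close>. Hence
  \<open>F(\<rho>, \<theta>) = f(\<rho>\<^sup>2 cos \<theta>, \<rho> sin \<theta>)\<close> has the form \<open>\<rho>\<^sup>4 g(\<rho>, \<theta>)\<close> with \<open>g(0, \<theta>) = q(cos \<theta>, sin \<theta>)\<close>
  (\<open>weighted_polar_limit\<close>), and ellipticity makes \<open>q\<close> positive on the circle (\<open>cusp_q_pos\<close>). The
  equation \<open>F(\<rho>, \<theta>) = t\<^sup>4\<close> is therefore equivalent, for \<open>\<rho>\<close> and \<open>t\<close> of the same sign, to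
  \<open>h(\<rho>, \<theta>) = t\<close> with \<open>h = \<rho> g\<^bsup>1/4\<^esup>\<close>. Since \<open>h\<close> increases with \<open>\<rho>\<close> near \<open>\<rho> = 0\<close>, it has a unique solution
  \<open>\<rho>(t, \<theta>)\<close>, and \<open>r = \<rho> / t = g(\<rho>(t, \<theta>), \<theta>)\<^bsup>-1/4\<^esup>\<close>.

  The differentiability of \<open>r\<close> is that of \<open>g\<close>. Taylor's formula with integral remainder expresses \<open>g\<close>
  as a weighted average, over the segment from the axis to the given point, of the fourth derivative
  of \<open>F\<close> in \<open>\<rho>\<close> (\<open>taylor_ray_avg\<close>), and such averages are as smooth as the averaged function
  (\<open>Cn_on_ray_avg\<close>). So \<open>g\<close>, and by the inverse function theorem (\<open>Cn_on_strip_inverse\<close>) also \<open>\<rho>\<close> and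
  \<open>r\<close>, are of class \<open>C\<^bsup>s-4\<^esup>\<close>. This covers the class \<open>[s/4]\<close> as soon as \<open>s \<ge> 5\<close>, and continuity
  for \<open>s = 4\<close>.

  Two points need care, and both are settled in \<open>radius_of_order\<close>. For \<open>s = 4\<close> the factor \<open>g\<close> is
  merely continuous, so its growth is out of control; that \<open>h\<close> is injective in \<open>\<rho>\<close> comes from \<open>F\<close> itself, whose
  derivative is \<open>\<rho>\<^sup>3\<close> times another positive average of the fourth derivative. And one \<open>\<epsilon>\<close>
  must serve all orders of differentiability at once; it depends only on a strip around the
  axis on which the fourth derivative of \<open>F\<close> in \<open>\<rho>\<close> has a positive lower bound, and such a
  strip exists by compactness of the circle.
\<close>

section \<open>Calculus of functions of class \<open>C\<^sup>n\<close>\<close>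

text \<open>Existence of the derivative function is quantified inside the class. These two rules keep that
  quantifier away from the simplifier.\<close>

lemma Cn_on_SucE:
  assumes "Cn_on (Suc n) f S"
  obtains f' where "\<And>x. x \<in> S \<Longrightarrow> (f has_derivative f' x) (at x within S)"
    "\<And>v. Cn_on n (\<lambda>x. f' x v) S"
  using assms by auto

lemma Cn_on_SucI:
  assumes "\<And>x. x \<in> S \<Longrightarrow> (f has_derivative f' x) (at x within S)"
    "\<And>v. Cn_on n (\<lambda>x. f' x v) S"
  shows "Cn_on (Suc n) f S"
  using assms by auto

lemma Cn_on_cong:
  assumes "Cn_on n f S" "\<And>x. x \<in> S \<Longrightarrow> f x = g x"
  shows "Cn_on n g S"
proof (cases n)
  case 0
  then show ?thesis using assms by (metis Cn_on.simps(1) continuous_on_cong)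
next
  case (Suc k)
  then obtain f' where f': "\<And>x. x \<in> S \<Longrightarrow> (f has_derivative f' x) (at x within S)"
    "\<And>v. Cn_on k (\<lambda>x. f' x v) S" using assms(1) by auto
  have "(g has_derivative f' x) (at x within S)" if "x \<in> S" for x
    using has_derivative_transform[OF that _ f'(1)[OF that]] assms(2) by metis
  then show ?thesis using f'(2) Suc by auto
qed

lemma Cn_on_subset:
  assumes "Cn_on n f S" "T \<subseteq> S"
  shows "Cn_on n f T"
  using assms
proof (induction n arbitrary: f)
  case 0
  then show ?case by (auto intro: continuous_on_subset)
next
  case (Suc n)
  obtain f' where "\<And>x. x \<in> S \<Longrightarrow> (f has_derivative f' x) (at x within S)"
    "\<And>v. Cn_on n (\<lambda>x. f' x v) S" using Cn_on_SucE[OF Suc.prems(1)] by metis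
  with Suc show ?case
    by (intro Cn_on_SucI[of T f f'] has_derivative_subset[of f _ _ S T]) auto
qed

lemma Cn_on_Suc_imp: "Cn_on (Suc n) f S \<Longrightarrow> Cn_on n f S"
proof (induction n arbitrary: f)
  case 0
  then show ?case by (auto simp: continuous_on_eq_continuous_within intro: has_derivative_continuous)
next
  case (Suc n)
  then show ?case by (metis Cn_on.simps(2))
qed

lemma Cn_on_antimono: "Cn_on n f S \<Longrightarrow> m \<le> n \<Longrightarrow> Cn_on m f S"
  by (rule inc_induct[of m n "\<lambda>k. Cn_on k f S"]) (auto intro: Cn_on_Suc_imp simp del: Cn_on.simps)

lemma Cn_on_imp_continuous_on: "Cn_on n f S \<Longrightarrow> continuous_on S f"
  using Cn_on_antimono[of n f S 0] by simp

lemma Cn_on_const: "Cn_on n (\<lambda>_. c) S"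
proof (induction n arbitrary: c)
  case (Suc n)
  then show ?case by (auto intro!: exI[of _ "\<lambda>_ _. 0"])
qed auto

lemma Cn_on_linear:
  assumes "bounded_linear L"
  shows "Cn_on n L S"
proof (cases n)
  case 0
  then show ?thesis using assms by (simp add: linear_continuous_on)
next
  case (Suc k)
  then show ?thesis using assms
    by (auto intro!: exI[of _ "\<lambda>_. L"] Cn_on_const bounded_linear_imp_has_derivative)
qed

lemma Cn_on_linear_compose:
  assumes "bounded_linear L" "Cn_on n f S"
  shows "Cn_on n (\<lambda>x. L (f x)) S"
  using assms(2)
proof (induction n arbitrary: f)
  case 0
  then show ?case using assms(1) by (simp add: bounded_linear.continuous_on)
next
  case (Suc n)
  then obtain f' where f': "\<And>x. x \<in> S \<Longrightarrow> (f has_derivative f' x) (at x within S)"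
    "\<And>v. Cn_on n (\<lambda>x. f' x v) S" by auto
  show ?case
    by (rule Cn_on_SucI[of S _ "\<lambda>x v. L (f' x v)"])
      (auto intro: f' Suc.IH bounded_linear.has_derivative[OF assms(1)])
qed

lemma Cn_on_add:
  assumes "Cn_on n f S" "Cn_on n g S"
  shows "Cn_on n (\<lambda>x. f x + g x) S"
  using assms
proof (induction n arbitrary: f g)
  case 0
  then show ?case by (auto intro: continuous_intros)
next
  case (Suc n)
  obtain f' where f': "\<And>x. x \<in> S \<Longrightarrow> (f has_derivative f' x) (at x within S)"
    "\<And>v. Cn_on n (\<lambda>x. f' x v) S" using Suc.prems by auto
  obtain g' where g': "\<And>x. x \<in> S \<Longrightarrow> (g has_derivative g' x) (at x within S)"
    "\<And>v. Cn_on n (\<lambda>x. g' x v) S" using Suc.prems by auto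
  show ?case using f' g' Suc.IH
    by (auto intro!: exI[of _ "\<lambda>x v. f' x v + g' x v"] has_derivative_add)
qed

lemma Cn_on_sum:
  "finite I \<Longrightarrow> (\<And>i. i \<in> I \<Longrightarrow> Cn_on n (f i) S) \<Longrightarrow> Cn_on n (\<lambda>x. \<Sum>i\<in>I. f i x) S"
  by (induction I rule: finite_induct) (simp_all add: Cn_on_const Cn_on_add)

lemma Cn_on_scaleR:
  fixes f :: "'a::real_normed_vector \<Rightarrow> real" and g :: "'a \<Rightarrow> 'b::real_normed_vector"
  assumes "Cn_on n f S" "Cn_on n g S"
  shows "Cn_on n (\<lambda>x. f x *\<^sub>R g x) S"
  using assms
proof (induction n arbitrary: f g)
  case 0
  then show ?case by (auto intro: continuous_intros)
next
  case (Suc n)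
  obtain f' where f': "\<And>x. x \<in> S \<Longrightarrow> (f has_derivative f' x) (at x within S)"
    "\<And>v. Cn_on n (\<lambda>x. f' x v) S" using Suc.prems by auto
  obtain g' where g': "\<And>x. x \<in> S \<Longrightarrow> (g has_derivative g' x) (at x within S)"
    "\<And>v. Cn_on n (\<lambda>x. g' x v) S" using Suc.prems by auto
  note * = Suc.prems[THEN Cn_on_Suc_imp]
  have "((\<lambda>x. f x *\<^sub>R g x) has_derivative (\<lambda>v. f x *\<^sub>R g' x v + f' x v *\<^sub>R g x)) (at x within S)"
    if "x \<in> S" for x
    using that f' g' by (auto intro: has_derivative_scaleR)
  then show ?case using f' g' * Suc.IH
    by (auto intro!: exI[of _ "\<lambda>x v. f x *\<^sub>R g' x v + f' x v *\<^sub>R g x"] Cn_on_add)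
qed

lemma Cn_on_mult:
  fixes f g :: "'a::real_normed_vector \<Rightarrow> real"
  shows "Cn_on n f S \<Longrightarrow> Cn_on n g S \<Longrightarrow> Cn_on n (\<lambda>x. f x * g x) S"
  using Cn_on_scaleR[of n f S g] by simp

lemma Cn_on_power:
  fixes f :: "'a::real_normed_vector \<Rightarrow> real"
  shows "Cn_on n f S \<Longrightarrow> Cn_on n (\<lambda>x. f x ^ k) S"
  by (induction k) (auto intro: Cn_on_const Cn_on_mult)

lemma Cn_on_Pair:
  assumes "Cn_on n f S" "Cn_on n g S"
  shows "Cn_on n (\<lambda>x. (f x, g x)) S"
proof -
  have "bounded_linear (\<lambda>x::'b. (x, 0::'c))" "bounded_linear (\<lambda>x::'c. (0::'b, x))"
    by (auto intro: bounded_linear_Pair bounded_linear_ident bounded_linear_zero)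
  from Cn_on_add[OF Cn_on_linear_compose[OF this(1) assms(1)] Cn_on_linear_compose[OF this(2) assms(2)]]
  show ?thesis by simp
qed

text \<open>The chain rule expands the outer derivative in a basis, so that the derivative of the
  composite is a sum of products of functions of lower class.\<close>

lemma Cn_on_compose:
  fixes f :: "'b::euclidean_space \<Rightarrow> 'c::real_normed_vector"
    and g :: "'a::real_normed_vector \<Rightarrow> 'b"
  assumes "Cn_on n f T" "Cn_on n g S" "g ` S \<subseteq> T"
  shows "Cn_on n (\<lambda>x. f (g x)) S"
  using assms
proof (induction n arbitrary: f g)
  case 0
  then show ?case by (auto intro: continuous_on_compose2)
next
  case (Suc n)
  obtain f' where f': "\<And>x. x \<in> T \<Longrightarrow> (f has_derivative f' x) (at x within T)"
    "\<And>v. Cn_on n (\<lambda>x. f' x v) T" using Cn_on_SucE[OF Suc.prems(1)] by metis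
  obtain g' where g': "\<And>x. x \<in> S \<Longrightarrow> (g has_derivative g' x) (at x within S)"
    "\<And>v. Cn_on n (\<lambda>x. g' x v) S" using Cn_on_SucE[OF Suc.prems(2)] by metis
  have gn: "Cn_on n g S" using Suc.prems Cn_on_Suc_imp by blast
  have "((\<lambda>x. f (g x)) has_derivative (\<lambda>v. f' (g x) (g' x v))) (at x within S)"
    if "x \<in> S" for x
    using has_derivative_in_compose[OF g'(1)[OF that]] that Suc.prems(3)
      has_derivative_subset[OF f'(1)] by (metis image_subset_iff)
  moreover have "Cn_on n (\<lambda>x. f' (g x) (g' x v)) S" for v
  proof (rule Cn_on_cong)
    show "Cn_on n (\<lambda>x. \<Sum>b\<in>Basis. (g' x v \<bullet> b) *\<^sub>R f' (g x) b) S"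
      by (intro Cn_on_sum Cn_on_scaleR Cn_on_linear_compose[OF bounded_linear_inner_left] g'(2) 
          Suc.IH[OF f'(2) gn Suc.prems(3)]) auto
    fix x assume "x \<in> S"
    then have "linear (f' (g x))" using f'(1) Suc.prems(3)
      by (meson has_derivative_linear image_subset_iff)
    then show "(\<Sum>b\<in>Basis. (g' x v \<bullet> b) *\<^sub>R f' (g x) b) = f' (g x) (g' x v)"
      using linear_sum[of "f' (g x)" "\<lambda>b. (g' x v \<bullet> b) *\<^sub>R b" Basis]
      by (simp add: linear_cmul euclidean_representation)
  qed
  ultimately show ?case by (rule Cn_on_SucI)
qed

text \<open>In one variable the iterated directional derivatives are multiples of the ordinary ones.\<close>

lemma Cn_on_real_Suc:
  fixes f :: "real \<Rightarrow> real"
  assumes "\<And>x. x \<in> S \<Longrightarrow> (f has_real_derivative f' x) (at x within S)" "Cn_on n f' S"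
  shows "Cn_on (Suc n) f S"
proof -
  have "Cn_on n (\<lambda>x. f' x * v) S" for v
    by (intro Cn_on_mult Cn_on_const assms)
  then show ?thesis using assms(1)
    by (auto intro!: exI[of _ "\<lambda>x v. f' x * v"] simp: has_field_derivative_def)
qed

lemma Cn_on_powr: "Cn_on n (\<lambda>x::real. x powr a) {0<..}"
proof (induction n arbitrary: a)
  case 0
  then show ?case by (auto intro!: continuous_intros)
next
  case (Suc n)
  have "Cn_on n (\<lambda>x::real. a * x powr (a - 1)) {0<..}"
    by (intro Cn_on_mult Cn_on_const Suc)
  then show ?case
    by (rule Cn_on_real_Suc[rotated]) (auto intro!: derivative_eq_intros simp: powr_diff)
qed

text \<open>Sine and cosine are each other's derivatives up to sign, hence the joint induction.\<close>

lemma Cn_on_sin_cos: "Cn_on n sin (S::real set) \<and> Cn_on n cos S"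
proof (induction n)
  case 0
  then show ?case by (auto intro!: continuous_intros)
next
  case (Suc n)
  then have "Cn_on n (\<lambda>x. - sin x) S"
    using Cn_on_mult[OF Cn_on_const[of n "-1"], of sin S] by simp
  then show ?case using Suc
    by (auto intro!: Cn_on_real_Suc[of S sin cos] Cn_on_real_Suc[of S cos "\<lambda>x. - sin x"]
        derivative_eq_intros simp del: Cn_on.simps)
qed

text \<open>On an open set the derivative is unique, so the derivative witnessing membership in the class
  may be chosen once and for all, independently of the order \<open>n\<close>. For functions of class
  \<open>C\<^sup>\<infinity>\<close> this is what makes the constructions below the same for every \<open>n\<close>.\<close>

lemma Cn_on_Suc_frechet:
  assumes "Cn_on (Suc n) f S" "open S"
  shows "x \<in> S \<Longrightarrow> (f has_derivative frechet_derivative f (at x)) (at x)"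
    and "Cn_on n (\<lambda>x. frechet_derivative f (at x) v) S"
proof -
  obtain f' where f': "\<And>x. x \<in> S \<Longrightarrow> (f has_derivative f' x) (at x within S)"
    "\<And>v. Cn_on n (\<lambda>x. f' x v) S" using assms by auto
  have f'': "(f has_derivative f' x) (at x)" if "x \<in> S" for x
    using f'(1)[OF that] at_within_open[OF that assms(2)] by simp
  then show "x \<in> S \<Longrightarrow> (f has_derivative frechet_derivative f (at x)) (at x)"
    using frechet_derivative_at by metis
  show "Cn_on n (\<lambda>x. frechet_derivative f (at x) v) S"
    by (rule Cn_on_cong[OF f'(2)[of v]]) (use f'' frechet_derivative_at in metis)
qed

section \<open>Averages along rays\<close>

text \<open>The first coordinate plays the part of a radius and may be negative: on an open strip
  derivatives are unique and the inverse mapping theorems apply on both sides of the axis.\<close>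

definition strip :: "real \<Rightarrow> (real \<times> real) set" where
  "strip a = {-a<..<a} \<times> UNIV"

lemma open_strip: "open (strip a)" and convex_strip: "convex (strip a)"
  by (auto simp: strip_def intro!: open_Times convex_Times)

lemma strip_shrink: "(x, y) \<in> strip a \<Longrightarrow> u \<in> {0..1} \<Longrightarrow> (u * x, y) \<in> strip a"
proof -
  assume "(x, y) \<in> strip a" "u \<in> {0..1}"
  then have "\<bar>x\<bar> < a" "\<bar>u * x\<bar> \<le> \<bar>x\<bar>"
    by (auto simp: strip_def abs_mult intro: mult_left_le_one_le)
  then show ?thesis by (auto simp: strip_def)
qed

text \<open>Every remainder term of Taylor's formula in the first variable, divided by the power of that
  variable, is an average of this shape.\<close>

definition ray_avg :: "(real \<Rightarrow> real) \<Rightarrow> (real \<times> real \<Rightarrow> real) \<Rightarrow> real \<times> real \<Rightarrow> real" where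
  "ray_avg w \<psi> = (\<lambda>(x, y). integral {0..1} (\<lambda>u. w u * \<psi> (u * x, y)))"

lemma continuous_on_ray:
  fixes \<psi> :: "real \<times> real \<Rightarrow> real"
  assumes "continuous_on (strip a) \<psi>" "continuous_on {0..1} w"
  shows "continuous_on (strip a \<times> {0..1}) (\<lambda>(p, u). w u * \<psi> (u * fst p, snd p))"
proof -
  have "continuous_on (strip a \<times> {0..1}) (\<lambda>z. w (snd z))"
    by (rule continuous_on_compose2[OF assms(2)]) (auto intro!: continuous_intros)
  moreover have "continuous_on (strip a \<times> {0..1}) (\<lambda>z. \<psi> (snd z * fst (fst z), snd (fst z)))"
    by (rule continuous_on_compose2[OF assms(1)]) 
      (auto intro!: continuous_intros strip_shrink)
  ultimately have "continuous_on (strip a \<times> {0..1}) (\<lambda>z. w (snd z) * \<psi> (snd z * fst (fst z), snd (fst z)))"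
    by (rule continuous_on_mult)
  then show ?thesis by (simp add: split_beta)
qed

lemma continuous_on_ray_slice:
  fixes \<psi> :: "real \<times> real \<Rightarrow> real"
  assumes "continuous_on (strip a) \<psi>" "continuous_on {0..1} w" "(x, y) \<in> strip a"
  shows "continuous_on {0..1} (\<lambda>u. w u * \<psi> (u * x, y))"
proof -
  have "continuous_on {0..1} ((\<lambda>(p, u). w u * \<psi> (u * fst p, snd p)) \<circ> (\<lambda>u. ((x, y), u)))"
    by (rule continuous_on_compose)
      (use assms(3) in \<open>auto intro!: continuous_intros continuous_on_subset[OF continuous_on_ray[OF assms(1,2)]]\<close>)
  then show ?thesis by (simp add: o_def)
qed

lemma continuous_on_ray_avg:
  assumes "continuous_on (strip a) \<psi>" "continuous_on {0..1} w"
  shows "continuous_on (strip a) (ray_avg w \<psi>)"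
  using integral_continuous_on_param[of "strip a" 0 1 "\<lambda>p u. w u * \<psi> (u * fst p, snd p)"]
    continuous_on_ray[OF assms] by (simp add: ray_avg_def split_beta)

text \<open>Differentiating under the integral sign turns an average with weight \<open>w u\<close> into averages of the
  partial derivatives with weights \<open>u * w u\<close> and \<open>w u\<close>. Quantifying over all continuous weights
  therefore closes the induction on the order.\<close>

lemma Cn_on_ray_avg:
  assumes "Cn_on n \<psi> (strip a)" "continuous_on {0..1} w"
  shows "Cn_on n (ray_avg w \<psi>) (strip a)"
  using assms
proof (induction n arbitrary: w \<psi>)
  case 0
  then show ?case by (simp add: continuous_on_ray_avg)
next
  case (Suc n)
  define D where "D v p = frechet_derivative \<psi> (at p) v" for v p
  have D: "(\<psi> has_derivative (\<lambda>v. D v p)) (at p)" if "p \<in> strip a" for p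
    using Cn_on_Suc_frechet(1)[OF Suc.prems(1) open_strip that] by (simp add: D_def)
  have DC: "Cn_on n (D v) (strip a)" for v
    using Cn_on_Suc_frechet(2)[OF Suc.prems(1) open_strip, of v] by (simp add: D_def[abs_def])
  note Dcont = DC[THEN Cn_on_imp_continuous_on]
  have split: "D (h, k) p = h * D (1, 0) p + k * D (0, 1) p" if "p \<in> strip a" for h k p
  proof -
    have lin: "linear (\<lambda>v. D v p)" using D[OF that] by (rule has_derivative_linear)
    have "D (h, k) p = D (h *\<^sub>R (1, 0) + k *\<^sub>R (0, 1)) p" by simp
    then show ?thesis by (simp only: linear_add[OF lin] linear_cmul[OF lin] real_scaleR_def)
  qed
  define w1 where "w1 u = u * w u" for u
  have w1: "continuous_on {0..1} w1" unfolding w1_def by (intro continuous_intros Suc.prems)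
  define A B where "A = (Blinfun fst :: (real \<times> real) \<Rightarrow>\<^sub>L real)"
    and "B = (Blinfun snd :: (real \<times> real) \<Rightarrow>\<^sub>L real)"
  have AB [simp]: "blinfun_apply A v = fst v" "blinfun_apply B v = snd v" for v
    by (simp_all add: A_def B_def bounded_linear_Blinfun_apply bounded_linear_fst bounded_linear_snd)
  define E where "E p u = (w1 u * D (1, 0) (u * fst p, snd p)) *\<^sub>R A
      + (w u * D (0, 1) (u * fst p, snd p)) *\<^sub>R B" for p u
  have Econt: "continuous_on (strip a \<times> {0..1}) (\<lambda>(p, u). E p u)"
    using continuous_on_ray[OF Dcont[of "(1,0)"] w1] continuous_on_ray[OF Dcont[of "(0,1)"] Suc.prems(2)]
    unfolding E_def split_beta
    by (intro continuous_on_add continuous_on_scaleR continuous_on_const)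
  have "(ray_avg w \<psi> has_derivative 
      (\<lambda>v. fst v * ray_avg w1 (D (1, 0)) p + snd v * ray_avg w (D (0, 1)) p)) (at p within strip a)"
    if p: "p \<in> strip a" for p
  proof -
    have "((\<lambda>p. integral (cbox 0 1) (\<lambda>u. w u * \<psi> (u * fst p, snd p))) has_derivative
        integral (cbox 0 1) (E p)) (at p within strip a)"
    proof (rule leibniz_rule[OF _ _ _ p convex_strip])
      fix q u assume q: "q \<in> strip a" and u: "u \<in> cbox 0 (1::real)"
      then have qu: "(u * fst q, snd q) \<in> strip a" using strip_shrink[of "fst q" "snd q" a u] by simp
      have "((\<lambda>q. \<psi> (u * fst q, snd q)) has_derivative (\<lambda>v. D (u * fst v, snd v) (u * fst q, snd q)))
          (at q within strip a)"
        by (rule has_derivative_compose[of "\<lambda>q. (u * fst q, snd q)" "\<lambda>v. (u * fst v, snd v)" q "strip a" \<psi>,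
              OF _ D[OF qu]]) (auto intro!: derivative_eq_intros)
      then have "((\<lambda>q. w u * \<psi> (u * fst q, snd q)) has_derivative
          (\<lambda>v. w u * D (u * fst v, snd v) (u * fst q, snd q))) (at q within strip a)"
        by (rule has_derivative_mult_right)
      moreover have "(\<lambda>v. w u * D (u * fst v, snd v) (u * fst q, snd q)) = blinfun_apply (E q u)"
        by (rule ext, subst split[OF qu]) (simp add: E_def blinfun.bilinear_simps w1_def algebra_simps)
      ultimately show "((\<lambda>q. w u * \<psi> (u * fst q, snd q)) has_derivative blinfun_apply (E q u))
          (at q within strip a)" by simp
    next
      fix q assume "q \<in> strip a"
      then show "(\<lambda>u. w u * \<psi> (u * fst q, snd q)) integrable_on cbox 0 1"
        using continuous_on_ray_slice[OF Cn_on_imp_continuous_on[OF Suc.prems(1)] Suc.prems(2), of "fst q" "snd q"]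
        by (auto intro: integrable_continuous_interval)
    qed (use Econt in simp)
    moreover have "blinfun_apply (integral (cbox 0 1) (E p)) v
        = fst v * ray_avg w1 (D (1, 0)) p + snd v * ray_avg w (D (0, 1)) p" for v
    proof -
      have "continuous_on {0..1} ((\<lambda>(p, u). E p u) \<circ> Pair p)"
        using p by (intro continuous_on_compose continuous_on_subset[OF Econt] continuous_intros) auto
      then have "E p integrable_on {0..1}"
        by (auto simp: o_def intro: integrable_continuous_interval)
      then have "blinfun_apply (integral (cbox 0 1) (E p)) v = integral {0..1} (\<lambda>u. blinfun_apply (E p u) v)"
        by (simp add: blinfun_apply_integral)
      also have "\<dots> = integral {0..1} (\<lambda>u. fst v * (w1 u * D (1, 0) (u * fst p, snd p))
          + snd v * (w u * D (0, 1) (u * fst p, snd p)))"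
        by (simp add: E_def blinfun.bilinear_simps algebra_simps)
      also have "\<dots> = fst v * ray_avg w1 (D (1, 0)) p + snd v * ray_avg w (D (0, 1)) p"
        unfolding ray_avg_def split_beta
        using continuous_on_ray_slice[OF Dcont[of "(1,0)"] w1, of "fst p" "snd p"]
          continuous_on_ray_slice[OF Dcont[of "(0,1)"] Suc.prems(2), of "fst p" "snd p"] p
        by (subst integral_add) (auto intro!: integrable_continuous_interval continuous_intros)
      finally show ?thesis .
    qed
    moreover have "ray_avg w \<psi> = (\<lambda>p. integral (cbox 0 1) (\<lambda>u. w u * \<psi> (u * fst p, snd p)))"
      by (auto simp: ray_avg_def)
    moreover from calculation(2) have "blinfun_apply (integral (cbox 0 1) (E p))
        = (\<lambda>v. fst v * ray_avg w1 (D (1, 0)) p + snd v * ray_avg w (D (0, 1)) p)" by (rule ext)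
    ultimately show ?thesis by simp
  qed
  then show ?case
  proof (rule Cn_on_SucI)
    fix v
    show "Cn_on n (\<lambda>p. fst v * ray_avg w1 (D (1, 0)) p + snd v * ray_avg w (D (0, 1)) p) (strip a)"
      by (intro Cn_on_add Cn_on_mult Cn_on_const Suc.IH DC w1 Suc.prems(2))
  qed
qed

section \<open>Taylor expansion in the first variable\<close>

text \<open>The partial derivative is given by an explicit term so that its iterates do not depend on the
  order of differentiability under consideration, and so that at \<open>(x, y)\<close> they see only the
  function on the line through \<open>y\<close>.\<close>

definition pd1 :: "(real \<times> real \<Rightarrow> real) \<Rightarrow> real \<times> real \<Rightarrow> real" where
  "pd1 \<psi> = (\<lambda>(x, y). deriv (\<lambda>x. \<psi> (x, y)) x)"

lemma pd1_iter_eqI: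
  assumes "\<And>x. \<psi> (x, y) = \<psi> (x, y')"
  shows "(pd1 ^^ k) \<psi> (x, y) = (pd1 ^^ k) \<psi> (x, y')"
  using assms by (induction k arbitrary: x) (auto simp: pd1_def)

lemma pd1:
  assumes "Cn_on (Suc n) \<psi> (strip a)"
  shows has_derivative_pd1: "(x, y) \<in> strip a \<Longrightarrow> ((\<lambda>x. \<psi> (x, y)) has_real_derivative pd1 \<psi> (x, y)) (at x)"
    and pd1_eq_frechet: "p \<in> strip a \<Longrightarrow> pd1 \<psi> p = frechet_derivative \<psi> (at p) (1, 0)"
    and Cn_on_pd1: "Cn_on n (pd1 \<psi>) (strip a)"
proof -
  have *: "((\<lambda>x. \<psi> (x, y)) has_real_derivative frechet_derivative \<psi> (at (x, y)) (1, 0)) (at x)"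
    if "(x, y) \<in> strip a" for x y
  proof -
    note D = Cn_on_Suc_frechet(1)[OF assms open_strip that]
    have "((\<lambda>x. \<psi> (x, y)) has_derivative (\<lambda>h. frechet_derivative \<psi> (at (x, y)) (h, 0))) (at x)"
      by (rule has_derivative_compose[of "\<lambda>x. (x, y)" "\<lambda>h. (h, 0)" x UNIV \<psi>, OF _ D])
         (auto intro!: derivative_eq_intros)
    moreover have "frechet_derivative \<psi> (at (x, y)) (h, 0) = frechet_derivative \<psi> (at (x, y)) (1, 0) * h" for h
      using linear_cmul[OF has_derivative_linear[OF D], of h "(1, 0)"] by simp
    then have "(\<lambda>h. frechet_derivative \<psi> (at (x, y)) (h, 0)) = (*) (frechet_derivative \<psi> (at (x, y)) (1, 0))"
      by (rule ext)
    ultimately show ?thesis by (simp only: has_field_derivative_def)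
  qed
  then have eq: "pd1 \<psi> p = frechet_derivative \<psi> (at p) (1, 0)" if "p \<in> strip a" for p
    using DERIV_imp_deriv[OF *, of "fst p" "snd p"] that by (simp add: pd1_def split_beta)
  show "((\<lambda>x. \<psi> (x, y)) has_real_derivative pd1 \<psi> (x, y)) (at x)" if "(x, y) \<in> strip a"
    unfolding eq[OF that] by (rule *[OF that])
  show "pd1 \<psi> p = frechet_derivative \<psi> (at p) (1, 0)" if "p \<in> strip a"
    using eq[OF that] .
  show "Cn_on n (pd1 \<psi>) (strip a)"
    by (rule Cn_on_cong[OF Cn_on_Suc_frechet(2)[OF assms open_strip]]) (rule eq[symmetric])
qed

lemma Cn_on_pd1_iter: "Cn_on (k + n) \<psi> (strip a) \<Longrightarrow> Cn_on n ((pd1 ^^ k) \<psi>) (strip a)"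
proof (induction k arbitrary: \<psi>)
  case (Suc k)
  then show ?case using Cn_on_pd1[of "k + n"] by (simp add: funpow_swap1 del: Cn_on.simps)
qed simp

text \<open>The kernel of the integral remainder of order \<open>n\<close> on the unit interval.\<close>

definition taylor_weight :: "nat \<Rightarrow> real \<Rightarrow> real" where
  "taylor_weight n u = (1 - u) ^ (n - 1) / fact (n - 1)"

lemma continuous_on_taylor_weight: "continuous_on S (taylor_weight n)"
  unfolding taylor_weight_def by (intro continuous_intros) auto

lemma integral_taylor_weight:
  assumes "0 < n"
  shows "(taylor_weight n has_integral 1 / fact n) {0..1}"
proof -
  have "(taylor_weight n has_integral (- ((1 - 1) ^ n / fact n)) - (- ((1 - 0) ^ n / fact n))) {0..1}"
    unfolding taylor_weight_def using assms
    by (intro fundamental_theorem_of_calculus)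
      (auto intro!: derivative_eq_intros simp: has_real_derivative_iff_has_vector_derivative[symmetric] fact_reduce[of n])
  then show ?thesis using assms by (simp add: zero_power)
qed

lemma ray_avg_taylor_weight_0:
  "0 < n \<Longrightarrow> ray_avg (taylor_weight n) \<psi> (0, y) = \<psi> (0, y) / fact n"
  using has_integral_mult_left[OF integral_taylor_weight, of n "\<psi> (0, y)"]
  by (auto simp: ray_avg_def dest!: integral_unique)

lemma ray_avg_taylor_weight_ge:
  assumes "continuous_on (strip a) \<psi>" "0 < n" "(x, y) \<in> strip a"
    and "\<And>p. p \<in> strip a \<Longrightarrow> m \<le> \<psi> p"
  shows "m / fact n \<le> ray_avg (taylor_weight n) \<psi> (x, y)"
proof -
  have i1: "((\<lambda>u. taylor_weight n u * \<psi> (u * x, y)) has_integral ray_avg (taylor_weight n) \<psi> (x, y)) {0..1}"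
    using continuous_on_ray_slice[OF assms(1) continuous_on_taylor_weight assms(3)]
    by (simp add: ray_avg_def integrable_continuous_interval integrable_integral)
  have i2: "((\<lambda>u. taylor_weight n u * m) has_integral 1 / fact n * m) {0..1}"
    by (rule has_integral_mult_left[OF integral_taylor_weight[OF assms(2)]])
  have "1 / fact n * m \<le> ray_avg (taylor_weight n) \<psi> (x, y)"
  proof (rule has_integral_le[OF i2 i1])
    fix u :: real assume u: "u \<in> {0..1}"
    show "taylor_weight n u * m \<le> taylor_weight n u * \<psi> (u * x, y)"
      by (intro mult_left_mono assms(4) strip_shrink[OF assms(3) u])
        (use u in \<open>auto simp: taylor_weight_def\<close>)
  qed
  then show ?thesis by simp
qed

text \<open>Division by \<open>x ^ n\<close> costs exactly \<open>n\<close> derivatives: the quotient is an average of the \<open>n\<close>-th partial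
  derivative. This is Taylor's formula with integral remainder, rescaled from \<open>[0, x]\<close> to the unit
  interval so that both signs of \<open>x\<close> are treated alike.\<close>

lemma taylor_ray_avg:
  assumes "Cn_on n \<psi> (strip a)" "0 < n" "(x, y) \<in> strip a"
    and "\<And>k. k < n \<Longrightarrow> (pd1 ^^ k) \<psi> (0, y) = 0"
  shows "\<psi> (x, y) = x ^ n * ray_avg (taylor_weight n) ((pd1 ^^ n) \<psi>) (x, y)"
proof -
  define Df where "Df k u = x ^ k * (pd1 ^^ k) \<psi> (u * x, y)" for k u
  have Df: "(Df k has_vector_derivative Df (Suc k) u) (at u within {0..1})"
    if "k < n" "0 \<le> u" "u \<le> 1" for k u
  proof -
    have "Cn_on (Suc 0) ((pd1 ^^ k) \<psi>) (strip a)"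
      using that Cn_on_antimono[OF assms(1), of "k + Suc 0"] by (intro Cn_on_pd1_iter) simp
    moreover have "(u * x, y) \<in> strip a" using that assms(3) strip_shrink by simp
    ultimately have "((\<lambda>x. (pd1 ^^ k) \<psi> (x, y)) has_real_derivative pd1 ((pd1 ^^ k) \<psi>) (u * x, y)) (at (u * x))"
      by (rule has_derivative_pd1)
    then have "((\<lambda>u. (pd1 ^^ k) \<psi> (u * x, y)) has_real_derivative pd1 ((pd1 ^^ k) \<psi>) (u * x, y) * x) (at u within {0..1})"
      by (rule DERIV_chain2[of "\<lambda>x. (pd1 ^^ k) \<psi> (x, y)" _ "\<lambda>u. u * x"]) (auto intro!: derivative_eq_intros)
    from DERIV_cmult[OF this, of "x ^ k"] show ?thesis
      unfolding Df_def has_real_derivative_iff_has_vector_derivative[symmetric]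
      by (simp add: mult_ac)
  qed
  from Taylor_integral[of n Df "Df 0" 0 1, OF assms(2) refl Df]
  have "Df 0 1 = (\<Sum>i<n. (1 - 0) ^ i / fact i * Df i 0)
      + integral {0..1} (\<lambda>u. (1 - u) ^ (n - 1) / fact (n - 1) * Df n u)" by simp
  also have "(\<Sum>i<n. (1 - 0) ^ i / fact i * Df i 0) = 0"
    using assms(4) by (simp add: Df_def)
  also have "integral {0..1} (\<lambda>u. (1 - u) ^ (n - 1) / fact (n - 1) * Df n u)
      = integral {0..1} (\<lambda>u. x ^ n * (taylor_weight n u * (pd1 ^^ n) \<psi> (u * x, y)))"
    by (simp add: Df_def taylor_weight_def mult_ac)
  finally show ?thesis by (simp add: Df_def ray_avg_def)
qed

lemma tendsto_strip_slice:
  assumes "continuous_on (strip a) \<psi>" "0 < a"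
  shows "((\<lambda>x. \<psi> (x, y)) \<longlongrightarrow> \<psi> (0, y)) (at 0)"
proof -
  have "(0, y) \<in> strip a" using assms(2) by (simp add: strip_def)
  then have "continuous (at (0, y)) \<psi>"
    using assms(1) continuous_on_eq_continuous_at[OF open_strip] by blast
  then have "isCont (\<lambda>x. \<psi> (x, y)) 0"
    by (intro isCont_o2[of 0 "\<lambda>x. (x, y)" \<psi>]) (auto intro!: continuous_intros)
  then show ?thesis by (simp add: isCont_def)
qed

text \<open>A growth condition determines the derivatives at \<open>0\<close>. If the derivatives below the \<open>k\<close>-th vanish,
  the remainder formula shows that \<open>\<psi> / x ^ k\<close> tends to the \<open>k\<close>-th derivative over \<open>k!\<close>, while for
  \<open>k < n\<close> the hypothesis makes the same quotient tend to \<open>0\<close>; at \<open>k = n\<close> it gives the limit \<open>L\<close>.\<close>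

lemma derivs_at_0_of_order:
  assumes C: "Cn_on n \<psi> (strip a)" and a: "0 < a" and n: "0 < n"
    and lim: "((\<lambda>x. \<psi> (x, y) / x ^ n) \<longlongrightarrow> L) (at 0)"
  shows "k < n \<Longrightarrow> (pd1 ^^ k) \<psi> (0, y) = 0" and "(pd1 ^^ n) \<psi> (0, y) = fact n * L"
proof -
  have main: "((\<lambda>x. \<psi> (x, y) / x ^ k) \<longlongrightarrow> (pd1 ^^ k) \<psi> (0, y) / fact k) (at 0)"
    if "k \<le> n" "\<And>i. i < k \<Longrightarrow> (pd1 ^^ i) \<psi> (0, y) = 0" for k
  proof (cases "k = 0")
    case True
    then show ?thesis using tendsto_strip_slice[OF Cn_on_imp_continuous_on[OF C] a] by simp
  next
    case False
    let ?g = "ray_avg (taylor_weight k) ((pd1 ^^ k) \<psi>)"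
    have Ck: "Cn_on k \<psi> (strip a)" using C that Cn_on_antimono by blast
    have "continuous_on (strip a) ((pd1 ^^ k) \<psi>)" using Cn_on_pd1_iter[of k 0] Ck by simp
    then have "((\<lambda>x. ?g (x, y)) \<longlongrightarrow> ?g (0, y)) (at 0)"
      by (intro tendsto_strip_slice[OF continuous_on_ray_avg a] continuous_on_taylor_weight)
    moreover have "\<forall>\<^sub>F x in at 0. ?g (x, y) = \<psi> (x, y) / x ^ k"
    proof -
      have "\<forall>\<^sub>F x in at 0. x \<in> {-a<..<a} - {0}" using a
        by (intro eventually_at_in_open) auto
      then show ?thesis
      proof eventually_elim
        case (elim x)
        have "\<psi> (x, y) = x ^ k * ?g (x, y)"
          by (rule taylor_ray_avg[OF Ck _ _ that(2)]) (use elim False in \<open>auto simp: strip_def\<close>)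
        then show ?case using elim by simp
      qed
    qed
    ultimately have "((\<lambda>x. \<psi> (x, y) / x ^ k) \<longlongrightarrow> ?g (0, y)) (at 0)"
      by (rule Lim_transform_eventually)
    then show ?thesis using False by (simp add: ray_avg_taylor_weight_0)
  qed
  have vanish: "(pd1 ^^ k) \<psi> (0, y) = 0" if "k < n" for k
    using that
  proof (induction k rule: less_induct)
    case (less k)
    have "((\<lambda>x. \<psi> (x, y) / x ^ n * x ^ (n - k)) \<longlongrightarrow> L * 0 ^ (n - k)) (at 0)"
      by (intro tendsto_intros lim)
    moreover have "\<forall>\<^sub>F x in at 0. \<psi> (x, y) / x ^ n * x ^ (n - k) = \<psi> (x, y) / x ^ k"
      using eventually_neq_at_within[of "0::real" 0]
    proof eventually_elim
      case (elim x)
      have "x ^ n = x ^ k * x ^ (n - k)" using less.prems by (simp flip: power_add)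
      then show ?case using elim by simp
    qed
    ultimately have "((\<lambda>x. \<psi> (x, y) / x ^ k) \<longlongrightarrow> L * 0 ^ (n - k)) (at 0)"
      by (rule Lim_transform_eventually)
    moreover have "((\<lambda>x. \<psi> (x, y) / x ^ k) \<longlongrightarrow> (pd1 ^^ k) \<psi> (0, y) / fact k) (at 0)"
      using less by (intro main) auto
    ultimately have "L * 0 ^ (n - k) = (pd1 ^^ k) \<psi> (0, y) / fact k"
      by (rule LIM_unique)
    then show ?case using less.prems by (simp add: power_0_left)
  qed
  then show "(pd1 ^^ k) \<psi> (0, y) = 0" if "k < n" using that by blast
  have "L = (pd1 ^^ n) \<psi> (0, y) / fact n"
    by (rule LIM_unique[OF lim main]) (auto intro: vanish)
  then show "(pd1 ^^ n) \<psi> (0, y) = fact n * L" by simp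
qed

section \<open>Inverting a strictly increasing family\<close>

declare Cn_on.simps(2) [simp del]

text \<open>The map \<open>\<sigma> = (\<rho>, snd)\<close> is a right inverse of \<open>(h, snd)\<close>, so the inverse function theorem gives
  the derivative of \<open>\<rho>\<close> as an expression in the first derivatives of \<open>h\<close> composed with \<open>\<sigma>\<close>. Hence
  each class reached by \<open>\<rho>\<close> yields the next one, up to the class of \<open>h\<close>.\<close>

lemma Cn_on_strip_inverse:
  assumes C: "Cn_on n h (strip d)" and cont: "continuous_on (strip e) \<rho>"
    and maps: "\<And>t y. (t, y) \<in> strip e \<Longrightarrow> (\<rho> (t, y), y) \<in> strip d"
    and inv: "\<And>t y. (t, y) \<in> strip e \<Longrightarrow> h (\<rho> (t, y), y) = t"
    and pos: "\<And>p. 0 < n \<Longrightarrow> p \<in> strip d \<Longrightarrow> 0 < pd1 h p"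
  shows "Cn_on n \<rho> (strip e)"
proof (cases n)
  case 0
  then show ?thesis using cont by simp
next
  case (Suc m)
  define \<sigma> where "\<sigma> p = (\<rho> p, snd p)" for p
  have \<sigma>: "\<sigma> p \<in> strip d" "h (\<sigma> p) = fst p" if "p \<in> strip e" for p
    using maps[of "fst p" "snd p"] inv[of "fst p" "snd p"] that by (auto simp: \<sigma>_def)
  have Cm: "Cn_on (Suc m) h (strip d)" using C Suc by simp
  define A where "A = pd1 h"
  define B where "B q = frechet_derivative h (at q) (0, 1)" for q
  have AC: "Cn_on m A (strip d)" and BC: "Cn_on m B (strip d)"
    using Cn_on_pd1[OF Cm] Cn_on_Suc_frechet(2)[OF Cm open_strip] by (auto simp: A_def B_def[abs_def])
  have Apos: "0 < A q" if "q \<in> strip d" for q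
    using pos that Suc by (simp add: A_def)
  have dh: "(h has_derivative (\<lambda>v. fst v * A q + snd v * B q)) (at q)" if q: "q \<in> strip d" for q
  proof -
    note D = Cn_on_Suc_frechet(1)[OF Cm open_strip q]
    note lin = has_derivative_linear[OF D]
    have "frechet_derivative h (at q) v = fst v * A q + snd v * B q" for v
    proof -
      have "v = fst v *\<^sub>R (1, 0) + snd v *\<^sub>R (0, 1)" by (cases v) simp
      then have "frechet_derivative h (at q) v
          = frechet_derivative h (at q) (fst v *\<^sub>R (1, 0) + snd v *\<^sub>R (0, 1))" by simp
      also have "\<dots> = fst v * frechet_derivative h (at q) (1, 0) + snd v * frechet_derivative h (at q) (0, 1)"
        by (simp only: linear_add[OF lin] linear_cmul[OF lin] real_scaleR_def)
      finally show ?thesis using pd1_eq_frechet[OF Cm q] by (simp add: A_def B_def)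
    qed
    then have "frechet_derivative h (at q) = (\<lambda>v. fst v * A q + snd v * B q)" by (rule ext)
    with D show ?thesis by simp
  qed
  have cont\<sigma>: "continuous_on (strip e) \<sigma>"
    unfolding \<sigma>_def by (intro continuous_intros cont)
  have d\<rho>: "(\<rho> has_derivative (\<lambda>v. (fst v - snd v * B (\<sigma> p)) * (A (\<sigma> p) powr (-1)))) (at p within strip e)"
    if p: "p \<in> strip e" for p
  proof -
    let ?a = "A (\<sigma> p)" and ?b = "B (\<sigma> p)"
    have a: "?a \<noteq> 0" "?a powr (-1) = inverse ?a"
      using Apos[OF \<sigma>(1)[OF p]] by (auto simp: powr_minus)
    have "(\<sigma> has_derivative (\<lambda>v. ((fst v - snd v * ?b) * (?a powr (-1)), snd v))) (at p)"
    proof (rule has_derivative_inverse_basic[where f = "\<lambda>q. (h q, snd q)" and T = "strip e"])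
      show "((\<lambda>q. (h q, snd q)) has_derivative (\<lambda>v. (fst v * ?a + snd v * ?b, snd v))) (at (\<sigma> p))"
        by (intro has_derivative_Pair dh \<sigma>(1)[OF p] has_derivative_snd has_derivative_ident)
      show "bounded_linear (\<lambda>v. ((fst v - snd v * ?b) * (?a powr (-1)), snd v))"
        by (intro bounded_linear_intros)
      show "(\<lambda>v. ((fst v - snd v * ?b) * (?a powr (-1)), snd v)) \<circ> (\<lambda>v. (fst v * ?a + snd v * ?b, snd v)) = id"
        using a by (auto simp: fun_eq_iff)
      show "continuous (at p) \<sigma>"
        using cont\<sigma> p continuous_on_eq_continuous_at[OF open_strip] by blast
      show "(h (\<sigma> z), snd (\<sigma> z)) = z" if "z \<in> strip e" for z
        using \<sigma>(2)[OF that] by (simp add: \<sigma>_def)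
    qed (use p open_strip in auto)
    from has_derivative_fst[OF this] show ?thesis
      by (auto simp: \<sigma>_def intro: has_derivative_at_withinI)
  qed
  have "Cn_on k \<rho> (strip e)" if "k \<le> Suc m" for k
    using that
  proof (induction k)
    case 0
    then show ?case using cont by simp
  next
    case (Suc k)
    have C\<sigma>: "Cn_on k \<sigma> (strip e)"
      unfolding \<sigma>_def using Suc.prems
      by (intro Cn_on_Pair Suc.IH Cn_on_linear[OF bounded_linear_snd]) simp
    have img: "\<sigma> ` strip e \<subseteq> strip d" using \<sigma>(1) by auto
    have km: "k \<le> m" using Suc.prems by simp
    have CA: "Cn_on k (\<lambda>p. A (\<sigma> p)) (strip e)" and CB: "Cn_on k (\<lambda>p. B (\<sigma> p)) (strip e)"
      using Cn_on_compose[OF Cn_on_antimono[OF AC km] C\<sigma> img]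
        Cn_on_compose[OF Cn_on_antimono[OF BC km] C\<sigma> img] by auto
    have CA': "Cn_on k (\<lambda>p. A (\<sigma> p) powr (-1)) (strip e)"
      by (rule Cn_on_compose[OF Cn_on_powr CA]) (rule image_subsetI, simp add: Apos \<sigma>(1))
    have CN: "Cn_on k (\<lambda>p. fst v + (- snd v) * B (\<sigma> p)) (strip e)" for v :: "real \<times> real"
      by (intro Cn_on_add Cn_on_mult Cn_on_const CB)
    show ?case
    proof (rule Cn_on_SucI[OF d\<rho>])
      fix v :: "real \<times> real"
      show "Cn_on k (\<lambda>p. (fst v - snd v * B (\<sigma> p)) * (A (\<sigma> p) powr (-1))) (strip e)"
        using Cn_on_mult[OF CN[of v] CA'] by simp
    qed
  qed
  then show ?thesis using Suc by simp
qed

section \<open>The radius function\<close>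

text \<open>Positivity on the axis persists on a whole strip because, up to repetition, the second variable
  ranges over a compact set.\<close>

lemma uniform_lower_bound_near_axis:
  fixes P :: "real \<times> real \<Rightarrow> real"
  assumes cont: "continuous_on (strip a) P" and a: "0 < a" and K: "compact K"
    and rep: "\<And>y. \<exists>y'\<in>K. \<forall>x. P (x, y) = P (x, y')"
    and pos: "\<And>y. 0 < P (0, y)"
  obtains m d where "0 < m" "0 < d" "d < a" "\<And>p. p \<in> strip d \<Longrightarrow> m \<le> P p"
proof -
  define C where "C = {-(a/2)..a/2} \<times> K"
  have CC: "compact C" unfolding C_def by (intro compact_Times K compact_Icc)
  have contC: "continuous_on C P"
    by (rule continuous_on_subset[OF cont]) (use a in \<open>auto simp: C_def strip_def\<close>)
  have "continuous_on K ((\<lambda>p. P p) \<circ> Pair 0)"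
    by (intro continuous_on_compose continuous_intros continuous_on_subset[OF contC])
      (use a in \<open>auto simp: C_def\<close>)
  moreover have "K \<noteq> {}" using rep by blast
  ultimately obtain y0 where y0: "\<And>y. y \<in> K \<Longrightarrow> P (0, y0) \<le> P (0, y)"
    using continuous_attains_inf[OF K, of "\<lambda>y. P (0, y)"] by (auto simp: o_def)
  define m where "m = P (0, y0) / 2"
  have m: "0 < m" using pos by (simp add: m_def)
  obtain \<delta> where \<delta>: "0 < \<delta>" "\<And>p q. p \<in> C \<Longrightarrow> q \<in> C \<Longrightarrow> dist q p < \<delta> \<Longrightarrow> dist (P q) (P p) < m"
    using compact_uniformly_continuous[OF contC CC] m unfolding uniformly_continuous_on_def by metis
  define d where "d = min \<delta> (a / 2)"
  have "m \<le> P (x, y)" if "(x, y) \<in> strip d" for x y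
  proof -
    obtain y' where y': "y' \<in> K" "P (x, y) = P (x, y')" using rep by blast
    have "\<bar>x\<bar> < \<delta>" "\<bar>x\<bar> < a / 2" using that by (auto simp: strip_def d_def)
    then have "dist (P (x, y')) (P (0, y')) < m"
      using y'(1) a by (intro \<delta>(2)) (auto simp: C_def dist_Pair_Pair)
    moreover have "2 * m \<le> P (0, y')" using y0[OF y'(1)] by (simp add: m_def)
    ultimately show ?thesis using y'(2) by (simp add: dist_real_def abs_less_iff)
  qed
  then show thesis using \<delta>(1) a m by (intro that[of m d]) (auto simp: d_def)
qed

text \<open>The analytic core. Write \<open>F (x, y) = x ^ n * g (x, y)\<close>; the equation \<open>F (x, y) = t ^ n\<close> then has the
  \<open>n\<close>-th root \<open>h (x, y) = x * g (x, y) powr (1 / n) = t\<close>, which is solved by \<open>x = \<rho> (t, y)\<close>. The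
  radius is \<open>R = \<rho> / t\<close>, but it is taken to be \<open>g (\<rho> (t, y), y) powr (- 1 / n)\<close>: this makes sense at
  \<open>t = 0\<close> and loses no derivative beyond the \<open>n\<close> lost in passing from \<open>F\<close> to \<open>g\<close>. The width \<open>e\<close>
  is fixed before the order \<open>k\<close>, as the case \<open>s = \<infinity>\<close> demands. The last clause says that \<open>R\<close>
  inherits the periodicity of \<open>F\<close>.\<close>

lemma radius_of_order:
  fixes F :: "real \<times> real \<Rightarrow> real"
  assumes n: "2 \<le> n" "enat n \<le> s" and a: "0 < a" and F: "C_on s F (strip a)"
    and K: "compact K" and rep: "\<And>y. \<exists>y'\<in>K. \<forall>x. F (x, y) = F (x, y')"
    and lim: "\<And>y. ((\<lambda>x. F (x, y) / x ^ n) \<longlongrightarrow> Q y) (at 0)" and Q: "\<And>y. 0 < Q y"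
  shows "\<exists>e>0. \<exists>R. 
      (\<forall>t y. (t, y) \<in> strip e \<longrightarrow>
        0 < R (t, y) \<and> (t * R (t, y), y) \<in> strip a \<and> F (t * R (t, y), y) = t ^ n)
    \<and> (\<forall>y. R (0, y) = Q y powr (- 1 / n))
    \<and> (\<forall>k. enat (n + k) \<le> s \<longrightarrow> Cn_on k R (strip e))
    \<and> (\<forall>t y y'. (\<forall>x. F (x, y) = F (x, y')) \<longrightarrow> R (t, y) = R (t, y'))"
proof -
  have FC: "Cn_on k F (strip a)" if "enat k \<le> s" for k
    using F that by (simp add: C_on_def)
  define P where "P = (pd1 ^^ n) F"
  have PC: "Cn_on k P (strip a)" if "enat (n + k) \<le> s" for k
    unfolding P_def by (rule Cn_on_pd1_iter[OF FC[OF that]])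
  have Pcont: "continuous_on (strip a) P"
    using PC[of 0] n by (simp add: Cn_on_imp_continuous_on)
  note at_0 = derivs_at_0_of_order[OF FC[OF n(2)] a _ lim]
  have P0: "P (0, y) = fact n * Q y" for y
    using at_0(2) n by (simp add: P_def)
  have Prep: "\<exists>y'\<in>K. \<forall>x. P (x, y) = P (x, y')" for y
    using rep[of y] pd1_iter_eqI[of F y] unfolding P_def by metis
  obtain m d where m: "0 < m" and d: "0 < d" "d < a" and Pm: "\<And>p. p \<in> strip d \<Longrightarrow> m \<le> P p"
    using uniform_lower_bound_near_axis[OF Pcont a K Prep] P0 Q by (metis fact_gt_zero mult_pos_pos)
  have sub: "strip d \<subseteq> strip a" using d by (auto simp: strip_def)
  note Pcont' = continuous_on_subset[OF Pcont sub]

  define g where "g = ray_avg (taylor_weight n) P"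
  define g' where "g' = ray_avg (taylor_weight (n - 1)) P"
  have gC: "Cn_on k g (strip a)" if "enat (n + k) \<le> s" for k
    unfolding g_def by (rule Cn_on_ray_avg[OF PC[OF that] continuous_on_taylor_weight])
  have Fg: "F (x, y) = x ^ n * g (x, y)" if "(x, y) \<in> strip a" for x y
    unfolding g_def P_def
    by (rule taylor_ray_avg[OF FC[OF n(2)] _ that at_0(1)]) (use n in auto)
  have Fg': "pd1 F (x, y) = x ^ (n - 1) * g' (x, y)" if "(x, y) \<in> strip a" for x y
  proof -
    have "Cn_on (n - 1) (pd1 F) (strip a)"
      using Cn_on_pd1[of "n - 1" F a] FC[OF n(2)] n by (simp del: Cn_on.simps)
    moreover have "(pd1 ^^ k) (pd1 F) (0, y) = 0" if "k < n - 1" for k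
      using at_0(1)[of "Suc k" y] that n by (simp add: funpow_swap1)
    moreover have "(pd1 ^^ (n - 1)) (pd1 F) = P"
      using n by (cases n) (simp_all add: P_def funpow_swap1)
    ultimately show ?thesis
      using taylor_ray_avg[of "n - 1" "pd1 F" a x y] that n by (simp add: g'_def)
  qed
  define c where "c = m / fact n"
  have c: "0 < c" using m by (simp add: c_def)
  have gc: "c \<le> g p" if "p \<in> strip d" for p
    using ray_avg_taylor_weight_ge[OF Pcont', of n "fst p" "snd p" m] that Pm n
    by (simp add: c_def g_def)
  have g'pos: "0 < g' p" if "p \<in> strip d" for p
  proof -
    have "m / fact (n - 1) \<le> g' p"
      using ray_avg_taylor_weight_ge[OF Pcont', of "n - 1" "fst p" "snd p" m] that Pm n
      by (simp add: g'_def)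
    moreover have "0 < m / fact (n - 1)" using m by simp
    ultimately show ?thesis by linarith
  qed
  have g0: "g (0, y) = Q y" for y
    using n by (simp add: g_def ray_avg_taylor_weight_0 P0)

  define k where "k p = g p powr (1 / n)" for p
  define h where "h p = fst p * k p" for p
  have kc: "c powr (1 / n) \<le> k p" if "p \<in> strip d" for p
    unfolding k_def using gc[OF that] c by (intro powr_mono2) auto
  have cpos: "0 < c powr (1 / n)" using c by simp
  have kpos: "0 < k p" if "p \<in> strip d" for p using kc[OF that] cpos by linarith
  have kn: "k p ^ n = g p" if "p \<in> strip d" for p
  proof -
    have "0 < g p" using gc[OF that] c by linarith
    then show ?thesis using n by (simp add: k_def powr_realpow[symmetric] powr_powr)
  qed
  have kC: "Cn_on i k (strip d)" if "enat (n + i) \<le> s" for i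
    unfolding k_def
    by (rule Cn_on_compose[OF Cn_on_powr Cn_on_subset[OF gC[OF that] sub]])
      (use gc c in \<open>force simp: less_le_trans\<close>)
  have hC: "Cn_on i h (strip d)" if "enat (n + i) \<le> s" for i
    unfolding h_def by (intro Cn_on_mult kC that Cn_on_linear bounded_linear_fst)
  have hF: "h (x, y) ^ n = F (x, y)" if "(x, y) \<in> strip d" for x y
    using Fg kn[OF that] that sub by (auto simp: h_def power_mult_distrib)
  have hcont: "continuous_on (strip d) h"
    using hC[of 0] n by (simp add: Cn_on_imp_continuous_on)
  have dF: "((\<lambda>x. F (x, y)) has_real_derivative x ^ (n - 1) * g' (x, y)) (at x)"
    if "(x, y) \<in> strip a" for x y
  proof -
    have "Cn_on (Suc 0) F (strip a)" using Cn_on_antimono[OF FC[OF n(2)]] n by simp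
    from has_derivative_pd1[OF this that] Fg'[OF that] show ?thesis by simp
  qed

  have sgn_h: "sgn (h (x, y)) = sgn x" if "(x, y) \<in> strip d" for x y
    using kpos[OF that] by (simp add: h_def sgn_mult)
  \<comment> \<open>When \<open>s = n\<close> the factor \<open>g\<close> is merely continuous, so the product \<open>x * k\<close> tells nothing about
    the monotonicity of \<open>h\<close>. Instead Rolle's theorem is applied to \<open>F\<close>, whose derivative
    \<open>x ^ (n - 1) * g' (x, y)\<close> vanishes only on the axis; \<open>h\<close> keeps the sign of \<open>x\<close>, so the two points
    lie on the same side.\<close>
  have inj_aux: False
    if x: "(x, y) \<in> strip d" "(x', y) \<in> strip d" "x < x'" "h (x, y) = h (x', y)" for x x' y
  proof -
    have "sgn x = sgn x'" using sgn_h x by metis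
    have "\<exists>z>x. z < x' \<and> ((\<lambda>x. F (x, y)) has_real_derivative 0) (at z)"
    proof (rule Rolle[OF x(3)])
      show "F (x, y) = F (x', y)" using hF x by metis
      have D: "((\<lambda>x. F (x, y)) has_real_derivative z ^ (n - 1) * g' (z, y)) (at z)" if "x \<le> z" "z \<le> x'" for z
        by (rule dF) (use x that d in \<open>auto simp: strip_def\<close>)
      show "continuous_on {x..x'} (\<lambda>x. F (x, y))"
        by (rule DERIV_continuous_on[OF DERIV_subset[OF D]]) auto
      show "(\<lambda>x. F (x, y)) differentiable at z" if "x < z" "z < x'" for z
        using D[of z] that real_differentiable_def by auto
    qed
    then obtain z where z: "x < z" "z < x'" "((\<lambda>x. F (x, y)) has_real_derivative 0) (at z)" by blast
    have zd: "(z, y) \<in> strip d" using x z by (auto simp: strip_def)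
    have "z \<noteq> 0" using \<open>sgn x = sgn x'\<close> z by (auto simp: sgn_if split: if_splits)
    moreover have "z ^ (n - 1) * g' (z, y) = 0"
      using DERIV_unique[OF dF z(3)] zd sub by auto
    ultimately show False using g'pos[OF zd] by simp
  qed
  have inj: "x = x'" if "(x, y) \<in> strip d" "(x', y) \<in> strip d" "h (x, y) = h (x', y)" for x x' y
    using inj_aux[of x y x'] inj_aux[of x' y x] that by (metis linorder_less_linear)

  \<comment> \<open>A lower bound for \<open>h (d / 2, y)\<close> and for \<open>- h (- d / 2, y)\<close>, valid for all \<open>y\<close>.\<close>
  define e where "e = d / 2 * c powr (1 / n)"
  have e: "0 < e" using d cpos by (simp add: e_def)
  have ex: "\<exists>x. (x, y) \<in> strip d \<and> h (x, y) = t" if ty: "(t, y) \<in> strip e" for t y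
  proof -
    have "continuous_on {-(d/2)..d/2} (h \<circ> (\<lambda>x. (x, y)))"
      by (intro continuous_on_compose continuous_intros continuous_on_subset[OF hcont])
        (use d in \<open>auto simp: strip_def\<close>)
    moreover have "e \<le> h (d/2, y)" "h (-(d/2), y) \<le> - e"
      unfolding h_def e_def fst_conv minus_mult_left [symmetric] neg_le_iff_le
      by (intro mult_left_mono kc; use d in \<open>simp add: strip_def\<close>)+
    ultimately obtain x where "-(d/2) \<le> x" "x \<le> d/2" "h (x, y) = t"
      using IVT'[of "h \<circ> (\<lambda>x. (x, y))" "-(d/2)" t "d/2"] ty d by (auto simp: strip_def)
    then show ?thesis using d by (intro exI[of _ x]) (auto simp: strip_def)
  qed
  define \<rho> where "\<rho> = (\<lambda>(t, y). SOME x. (x, y) \<in> strip d \<and> h (x, y) = t)"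
  have \<rho>: "(\<rho> (t, y), y) \<in> strip d" "h (\<rho> (t, y), y) = t" if "(t, y) \<in> strip e" for t y
    using someI_ex[OF ex[OF that]] by (auto simp: \<rho>_def)
  define \<sigma> where "\<sigma> p = (\<rho> p, snd p)" for p
  have \<sigma>d: "\<sigma> ` strip e \<subseteq> strip d" using \<rho>(1) by (auto simp: \<sigma>_def)
  have \<rho>cont: "continuous_on (strip e) \<rho>"
  proof -
    \<comment> \<open>Invariance of domain gives continuity of the inverse from injectivity and continuity.\<close>
    let ?H = "\<lambda>p. (h p, snd p)"
    have "inj_on ?H (strip d)" using inj by (auto simp: inj_on_def)
    moreover have "continuous_on (strip d) ?H" by (intro continuous_intros hcont)
    ultimately obtain G where G: "homeomorphism (strip d) (?H ` strip d) ?H G"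
      using invariance_of_domain_homeomorphism[OF open_strip] by (metis order_refl)
    have HS: "?H (\<sigma> p) = p" if "p \<in> strip e" for p
      using \<rho>(2)[of "fst p" "snd p"] that by (simp add: \<sigma>_def)
    then have "strip e \<subseteq> ?H ` strip d" using \<sigma>d by force
    then have "continuous_on (strip e) G"
      using homeomorphism_cont2[OF G] continuous_on_subset by blast
    then have "continuous_on (strip e) (\<lambda>p. fst (G p))" by (intro continuous_intros)
    moreover have "fst (G p) = \<rho> p" if "p \<in> strip e" for p
      using homeomorphism_apply1[OF G, of "\<sigma> p"] HS[OF that] that \<sigma>d by (auto simp: \<sigma>_def)
    ultimately show ?thesis by (metis (no_types, lifting) continuous_on_cong)
  qed

  \<comment> \<open>Off the axis compare the two expressions \<open>n * h ^ (n - 1) * h'\<close> and \<open>x ^ (n - 1) * g'\<close> for the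
    derivative of \<open>F = h ^ n\<close>; on the axis, where both vanish, use the product rule for \<open>x * k\<close>.\<close>
  have dh_pos: "0 < pd1 h p" if C: "Cn_on (Suc 0) h (strip d)" "Cn_on (Suc 0) k (strip d)"
    and p: "p \<in> strip d" for p
  proof -
    obtain x y where [simp]: "p = (x, y)" by (cases p)
    have xy: "(x, y) \<in> strip d" using p by simp
    note dh = has_derivative_pd1[OF C(1) xy]
    show ?thesis
    proof (cases "x = 0")
      case True
      have "((\<lambda>x. x * k (x, y)) has_real_derivative 1 * k (x, y) + pd1 k (x, y) * x) (at x)"
        by (intro DERIV_mult DERIV_ident has_derivative_pd1[OF C(2) xy])
      then have "pd1 h (x, y) = k (x, y)"
        using DERIV_unique[OF dh] True by (simp add: h_def)
      then show ?thesis using kpos[OF xy] by simp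
    next
      case False
      have "((\<lambda>x. h (x, y) ^ n) has_real_derivative n * (pd1 h (x, y) * h (x, y) ^ (n - 1))) (at x)"
        using DERIV_power[OF dh, of n] by simp
      moreover have "((\<lambda>x. h (x, y) ^ n) has_real_derivative x ^ (n - 1) * g' (x, y)) (at x)"
      proof (rule has_field_derivative_transform_within_open[OF dF])
        show "(x, y) \<in> strip a" using xy sub by blast
        show "x \<in> {-d<..<d}" using xy by (auto simp: strip_def)
        show "F (z, y) = h (z, y) ^ n" if "z \<in> {-d<..<d}" for z
          using hF[of z y] that by (simp add: strip_def)
      qed simp
      ultimately have "n * (pd1 h (x, y) * h (x, y) ^ (n - 1)) = x ^ (n - 1) * g' (x, y)"
        by (rule DERIV_unique)
      then have "x ^ (n - 1) * (n * pd1 h (x, y) * k (x, y) ^ (n - 1)) = x ^ (n - 1) * g' (x, y)"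
        by (simp add: h_def power_mult_distrib mult_ac)
      then have "n * pd1 h (x, y) * k (x, y) ^ (n - 1) = g' (x, y)" using False by simp
      then have "0 < n * pd1 h (x, y) * k (x, y) ^ (n - 1)" using g'pos[OF xy] by simp
      then show ?thesis using kpos[OF xy] n by (simp add: zero_less_mult_iff)
    qed
  qed
  have \<rho>C: "Cn_on i \<rho> (strip e)" if i: "enat (n + i) \<le> s" for i
  proof (rule Cn_on_strip_inverse[OF hC[OF i] \<rho>cont \<rho>])
    fix p assume "0 < i" "p \<in> strip d"
    then show "0 < pd1 h p"
      using dh_pos Cn_on_antimono[OF hC[OF i], of "Suc 0"] Cn_on_antimono[OF kC[OF i], of "Suc 0"]
      by (simp del: Cn_on.simps)
  qed

  define R where "R p = k (\<sigma> p) powr (- 1)" for p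
  have tR: "t * R (t, y) = \<rho> (t, y)" if "(t, y) \<in> strip e" for t y
  proof -
    have "0 < k (\<rho> (t, y), y)" using kpos \<rho>(1)[OF that] by blast
    moreover have "t = \<rho> (t, y) * k (\<rho> (t, y), y)" using \<rho>(2)[OF that] by (simp add: h_def)
    ultimately show ?thesis by (simp add: R_def \<sigma>_def powr_minus field_simps)
  qed
  show ?thesis
  proof (intro exI[of _ e] exI[of _ R] conjI allI impI e)
    fix t y assume ty: "(t, y) \<in> strip e"
    show "0 < R (t, y)" using kpos[of "\<sigma> (t, y)"] \<sigma>d ty by (auto simp: R_def)
    show "(t * R (t, y), y) \<in> strip a" using tR[OF ty] \<rho>(1)[OF ty] sub by auto
    show "F (t * R (t, y), y) = t ^ n" using tR[OF ty] hF[OF \<rho>(1)[OF ty]] \<rho>(2)[OF ty] by simp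
  next
    fix y
    have "(0, y) \<in> strip e" "(0, y) \<in> strip d" using e d by (auto simp: strip_def)
    then have "\<rho> (0, y) = 0"
      using inj[of "\<rho> (0, y)" y 0] \<rho>[of 0 y] by (simp add: h_def)
    then show "R (0, y) = Q y powr (- 1 / n)"
      using Q[of y] by (simp add: R_def \<sigma>_def k_def g0 powr_minus_divide)
  next
    fix i assume i: "enat (n + i) \<le> s"
    have "Cn_on i \<sigma> (strip e)"
      unfolding \<sigma>_def by (intro Cn_on_Pair \<rho>C[OF i] Cn_on_linear bounded_linear_snd)
    then have "Cn_on i (\<lambda>p. k (\<sigma> p)) (strip e)" by (rule Cn_on_compose[OF kC[OF i] _ \<sigma>d])
    then show "Cn_on i R (strip e)"
      unfolding R_def by (rule Cn_on_compose[OF Cn_on_powr]) (use kpos \<sigma>d in blast)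
  next
    fix t y y' assume "\<forall>x. F (x, y) = F (x, y')"
    then have "P (x, y) = P (x, y')" for x unfolding P_def by (intro pd1_iter_eqI) simp
    then have "g (x, y) = g (x, y')" for x by (simp add: g_def ray_avg_def)
    then have k: "k (x, y) = k (x, y')" "h (x, y) = h (x, y')" for x by (simp_all add: k_def h_def)
    then have "\<rho> (t, y) = \<rho> (t, y')" by (simp add: \<rho>_def strip_def)
    then show "R (t, y) = R (t, y')" using k by (simp add: R_def \<sigma>_def)
  qed
qed

section \<open>Elliptic cusps of Gauss\<close>

text \<open>Ellipticity is the condition under which completing the square in \<open>x\<close> leaves a positive multiple
  of \<open>y^4\<close>.\<close>

lemma cusp_q_pos:
  assumes "\<kappa>\<^sub>1 > 0" "b\<^sub>2^2 < 2 * \<kappa>\<^sub>1 * c\<^sub>4" "(x, y) \<noteq> (0, 0)"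
  shows "0 < cusp_q \<kappa>\<^sub>1 b\<^sub>2 c\<^sub>4 x y"
proof -
  have eq: "2 * \<kappa>\<^sub>1 * cusp_q \<kappa>\<^sub>1 b\<^sub>2 c\<^sub>4 x y = (\<kappa>\<^sub>1 * x + b\<^sub>2 * y^2)^2 + (2 * \<kappa>\<^sub>1 * c\<^sub>4 - b\<^sub>2^2) * y^4"
    by (simp add: cusp_q_def power2_eq_square power4_eq_xxxx algebra_simps)
  have "0 < 2 * \<kappa>\<^sub>1 * cusp_q \<kappa>\<^sub>1 b\<^sub>2 c\<^sub>4 x y"
  proof (cases "y = 0")
    case True
    then show ?thesis unfolding eq using assms by simp
  next
    case False
    then have "0 < (2 * \<kappa>\<^sub>1 * c\<^sub>4 - b\<^sub>2^2) * y^4" using assms(2) by simp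
    then show ?thesis unfolding eq by (intro add_nonneg_pos) auto
  qed
  then show ?thesis using assms(1) by (simp add: zero_less_mult_iff)
qed

definition weighted_polar :: "real \<times> real \<Rightarrow> real \<times> real" where
  "weighted_polar = (\<lambda>(\<rho>, \<theta>). (\<rho>^2 * cos \<theta>, \<rho> * sin \<theta>))"

lemma norm_weighted_polar_le:
  assumes "\<bar>\<rho>\<bar> \<le> 1"
  shows "norm (weighted_polar (\<rho>, \<theta>)) \<le> \<bar>\<rho>\<bar>"
proof -
  have "\<rho>^2 \<le> 1" using assms by (simp add: abs_square_le_1)
  then have "\<rho>^2 * (\<rho>^2 * (cos \<theta>)^2) \<le> 1 * (\<rho>^2 * (cos \<theta>)^2)" by (intro mult_right_mono) auto
  then have "(\<rho>^2 * cos \<theta>)^2 + (\<rho> * sin \<theta>)^2 \<le> \<rho>^2 * (cos \<theta>)^2 + \<rho>^2 * (sin \<theta>)^2"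
    by (simp add: power2_eq_square mult_ac)
  also have "\<dots> = \<rho>^2" by (simp flip: distrib_left)
  finally have "sqrt ((\<rho>^2 * cos \<theta>)^2 + (\<rho> * sin \<theta>)^2) \<le> sqrt (\<rho>^2)" by (rule real_sqrt_le_mono)
  then show ?thesis by (simp add: weighted_polar_def norm_Pair)
qed

lemma weighted_polar_strip: "weighted_polar ` strip 1 \<subseteq> ball 0 1"
proof (rule image_subsetI)
  fix p :: "real \<times> real" assume "p \<in> strip 1"
  then have "\<bar>fst p\<bar> < 1" by (auto simp: strip_def)
  then show "weighted_polar p \<in> ball 0 1" using norm_weighted_polar_le[of "fst p" "snd p"] by simp
qed

lemma Cn_on_weighted_polar: "Cn_on n weighted_polar S"
proof -
  have "Cn_on n (\<lambda>p::real \<times> real. cos (snd p)) S" "Cn_on n (\<lambda>p::real \<times> real. sin (snd p)) S"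
    using Cn_on_sin_cos[of n UNIV]
    by (auto intro: Cn_on_compose[OF _ Cn_on_linear[OF bounded_linear_snd]])
  then have *: "Cn_on n (\<lambda>p::real \<times> real. fst p ^ 2 * cos (snd p)) S"
    "Cn_on n (\<lambda>p::real \<times> real. fst p * sin (snd p)) S"
    by (auto intro!: Cn_on_mult Cn_on_power intro: Cn_on_linear[OF bounded_linear_fst])
  have "weighted_polar = (\<lambda>p. (fst p ^ 2 * cos (snd p), fst p * sin (snd p)))"
    by (auto simp: weighted_polar_def)
  then show ?thesis using Cn_on_Pair[OF *] by simp
qed

text \<open>With weights 2 and 1 for \<open>x\<close> and \<open>y\<close>, the three monomials of \<open>q\<close> have weight 4 and all others
  have weight at least 5. The remainder is controlled because its argument has norm at most
  \<open>\<bar>\<rho>\<bar>\<close> once \<open>\<bar>\<rho>\<bar> \<le> 1\<close>.\<close>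

lemma weighted_polar_limit:
  fixes f :: "real \<times> real \<Rightarrow> real"
  assumes "(\<lambda>(x, y). f (x, y) -
            (1/2 * \<kappa>\<^sub>1 * x^2 + b\<^sub>0 * x^3 + b\<^sub>1 * x^2 * y + b\<^sub>2 * x * y^2
             + c\<^sub>0 * x^4 + c\<^sub>1 * x^3 * y + c\<^sub>2 * x^2 * y^2 + c\<^sub>3 * x * y^3 + c\<^sub>4 * y^4))
          \<in> o[at (0, 0)](\<lambda>p. norm p ^ 4)"
  shows "((\<lambda>\<rho>. f (weighted_polar (\<rho>, \<theta>)) / \<rho>^4) \<longlongrightarrow> cusp_q \<kappa>\<^sub>1 b\<^sub>2 c\<^sub>4 (cos \<theta>) (sin \<theta>)) (at 0)"
proof -
  define w where "w \<rho> = weighted_polar (\<rho>, \<theta>)" for \<rho>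
  define T where "T = (\<lambda>(x, y). 1/2 * \<kappa>\<^sub>1 * x^2 + b\<^sub>0 * x^3 + b\<^sub>1 * x^2 * y + b\<^sub>2 * x * y^2
             + c\<^sub>0 * x^4 + c\<^sub>1 * x^3 * y + c\<^sub>2 * x^2 * y^2 + c\<^sub>3 * x * y^3 + c\<^sub>4 * y^4)"
  have "(\<lambda>(x, y). f (x, y) - T (x, y)) \<in> o[at (0, 0)](\<lambda>p. norm p ^ 4)"
    unfolding T_def prod.case by (rule assms)
  moreover have "(\<lambda>(x, y). f (x, y) - T (x, y)) = (\<lambda>p. f p - T p)" by auto
  ultimately have o: "(\<lambda>p. f p - T p) \<in> o[at (0, 0)](\<lambda>p. norm p ^ 4)" by simp
  have "filterlim w (at (0, 0)) (at 0)"
  proof (rule filterlim_atI)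
    have "((\<lambda>\<rho>. (\<rho>^2 * cos \<theta>, \<rho> * sin \<theta>)) \<longlongrightarrow> (0^2 * cos \<theta>, 0 * sin \<theta>)) (at 0)"
      by (intro tendsto_intros)
    then show "(w \<longlongrightarrow> (0, 0)) (at 0)" by (simp add: w_def[abs_def] weighted_polar_def)
    have "w \<rho> \<noteq> (0, 0)" if "\<rho> \<noteq> 0" for \<rho>
      using that sin_zero_abs_cos_one[of \<theta>] by (auto simp: w_def weighted_polar_def)
    then show "\<forall>\<^sub>F \<rho> in at 0. w \<rho> \<noteq> (0, 0)"
      by (rule eventually_mono[OF eventually_neq_at_within])
  qed
  from landau_o.small.compose[OF o this]
  have "(\<lambda>\<rho>. f (w \<rho>) - T (w \<rho>)) \<in> o[at 0](\<lambda>\<rho>. norm (w \<rho>) ^ 4)" .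
  also have "(\<lambda>\<rho>. norm (w \<rho>) ^ 4) \<in> O[at 0](\<lambda>\<rho>. \<rho>^4)"
  proof (rule bigoI[where c = 1])
    have "\<forall>\<^sub>F \<rho>::real in at 0. \<bar>\<rho>\<bar> < 1"
      using eventually_at[of "\<lambda>\<rho>::real. \<bar>\<rho>\<bar> < 1" 0 UNIV] by (auto intro: exI[of _ 1])
    then show "\<forall>\<^sub>F \<rho> in at 0. norm (norm (w \<rho>) ^ 4) \<le> 1 * norm (\<rho>^4)"
    proof eventually_elim
      case (elim \<rho>)
      have "norm (w \<rho>) ^ 4 \<le> \<bar>\<rho>\<bar> ^ 4"
        unfolding w_def using elim by (intro power_mono norm_weighted_polar_le) auto
      then show ?case by simp
    qed
  qed
  finally have "((\<lambda>\<rho>. (f (w \<rho>) - T (w \<rho>)) / \<rho>^4) \<longlongrightarrow> 0) (at 0)"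
    by (rule smalloD_tendsto)
  moreover define q where "q = cusp_q \<kappa>\<^sub>1 b\<^sub>2 c\<^sub>4 (cos \<theta>) (sin \<theta>)"
  define c s where "c = cos \<theta>" and "s = sin \<theta>"
  define E where "E \<rho> = q + \<rho> * (b\<^sub>1 * c^2 * s + c\<^sub>3 * c * s^3) + \<rho>^2 * (b\<^sub>0 * c^3 + c\<^sub>2 * c^2 * s^2)
      + \<rho>^3 * (c\<^sub>1 * c^3 * s) + \<rho>^4 * (c\<^sub>0 * c^4)" for \<rho>
  have "(E \<longlongrightarrow> q + 0 * (b\<^sub>1 * c^2 * s + c\<^sub>3 * c * s^3) + 0^2 * (b\<^sub>0 * c^3 + c\<^sub>2 * c^2 * s^2)
      + 0^3 * (c\<^sub>1 * c^3 * s) + 0^4 * (c\<^sub>0 * c^4)) (at 0)"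
    unfolding E_def by (intro tendsto_intros)
  then have "(E \<longlongrightarrow> q) (at 0)" by simp
  ultimately have "((\<lambda>\<rho>. (f (w \<rho>) - T (w \<rho>)) / \<rho>^4 + E \<rho>) \<longlongrightarrow> 0 + q) (at 0)"
    by (rule tendsto_add)
  moreover have "\<forall>\<^sub>F \<rho> in at 0. (f (w \<rho>) - T (w \<rho>)) / \<rho>^4 + E \<rho> = f (w \<rho>) / \<rho>^4"
    using eventually_neq_at_within[of "0::real" 0]
  proof eventually_elim
    case (elim \<rho>)
    have "T (w \<rho>) = \<rho>^4 * E \<rho>"
      unfolding T_def w_def weighted_polar_def E_def q_def cusp_q_def c_def s_def
      by (simp add: power2_eq_square power3_eq_cube power4_eq_xxxx algebra_simps)
    then show ?case using elim by (simp add: diff_divide_distrib)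
  qed
  ultimately show ?thesis
    unfolding w_def q_def by (simp add: Lim_transform_eventually)
qed

theorem proposition4:
  fixes f :: "real \<times> real \<Rightarrow> real" and s :: enat
    and \<kappa>\<^sub>1 b\<^sub>0 b\<^sub>1 b\<^sub>2 c\<^sub>0 c\<^sub>1 c\<^sub>2 c\<^sub>3 c\<^sub>4 :: real
  assumes "4 \<le> s"
    and "C_on s f (ball 0 1)"
    and "(\<lambda>(x, y). f (x, y) -
            (1/2 * \<kappa>\<^sub>1 * x^2 + b\<^sub>0 * x^3 + b\<^sub>1 * x^2 * y + b\<^sub>2 * x * y^2
             + c\<^sub>0 * x^4 + c\<^sub>1 * x^3 * y + c\<^sub>2 * x^2 * y^2 + c\<^sub>3 * x * y^3 + c\<^sub>4 * y^4))
          \<in> o[at (0, 0)](\<lambda>p. norm p ^ 4)"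
    and "\<kappa>\<^sub>1 > 0"
    and "b\<^sub>2^2 < 2 * \<kappa>\<^sub>1 * c\<^sub>4"
  shows "\<exists>\<epsilon>>0. \<exists>r :: real \<times> (real \<times> real) \<Rightarrow> real.
           (\<forall>t\<in>{0..<\<epsilon>}. \<forall>p\<in>unit_circle. r (t, p) > 0)
         \<and> C_on_collar (if s = 4 then 0 else quarter s) \<epsilon> r
         \<and> (\<forall>\<theta>. r (0, circle_pt \<theta>) = cusp_r0 \<kappa>\<^sub>1 b\<^sub>2 c\<^sub>4 \<theta>)
         \<and> (\<forall>t\<in>{0..<\<epsilon>}. \<forall>\<theta>.
              let \<rho> = t * r (t, circle_pt \<theta>); p = (\<rho>^2 * cos \<theta>, \<rho> * sin \<theta>)
              in p \<in> ball 0 1 \<and> f p = t^4)"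
proof -
  define F where "F p = f (weighted_polar p)" for p
  define q where "q \<theta> = cusp_q \<kappa>\<^sub>1 b\<^sub>2 c\<^sub>4 (cos \<theta>) (sin \<theta>)" for \<theta>
  have FC: "C_on s F (strip 1)"
    using assms(2) unfolding C_on_def F_def
    by (intro allI impI Cn_on_compose[OF _ Cn_on_weighted_polar weighted_polar_strip]) simp
  have Feq: "F (x, \<theta>) = F (x, \<theta>')" if "circle_pt \<theta> = circle_pt \<theta>'" for x \<theta> \<theta>'
    using that by (simp add: F_def weighted_polar_def circle_pt_def)
  have rep: "\<exists>\<theta>'\<in>{0..2 * pi}. \<forall>x. F (x, \<theta>) = F (x, \<theta>')" for \<theta>
  proof -
    obtain \<theta>' where "0 \<le> \<theta>'" "\<theta>' \<le> 2 * pi" "cos \<theta> = cos \<theta>'" "sin \<theta> = sin \<theta>'"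
      using sincos_total_2pi_le[of "cos \<theta>" "sin \<theta>"] by auto
    then show ?thesis by (intro bexI[of _ \<theta>'] allI Feq) (auto simp: circle_pt_def)
  qed
  have lim: "((\<lambda>x. F (x, \<theta>) / x ^ 4) \<longlongrightarrow> q \<theta>) (at 0)" for \<theta>
    using weighted_polar_limit[OF assms(3)] by (simp add: F_def q_def)
  have qpos: "0 < q \<theta>" for \<theta>
    unfolding q_def using sin_zero_abs_cos_one[of \<theta>]
    by (intro cusp_q_pos assms(4,5)) auto
  have s4: "enat 4 \<le> s" using assms(1) by (simp add: numeral_eq_enat)
  obtain e R where e: "0 < e"
    and R: "\<And>t \<theta>. (t, \<theta>) \<in> strip e \<Longrightarrow>
        0 < R (t, \<theta>) \<and> (t * R (t, \<theta>), \<theta>) \<in> strip 1 \<and> F (t * R (t, \<theta>), \<theta>) = t ^ 4"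
    and R0: "\<And>\<theta>. R (0, \<theta>) = q \<theta> powr (- 1 / real 4)"
    and RC: "\<And>k. enat (4 + k) \<le> s \<Longrightarrow> Cn_on k R (strip e)"
    and Req: "\<And>t \<theta> \<theta>'. \<forall>x. F (x, \<theta>) = F (x, \<theta>') \<Longrightarrow> R (t, \<theta>) = R (t, \<theta>')"
    using radius_of_order[OF _ s4 zero_less_one FC compact_Icc rep lim qpos] by auto
  \<comment> \<open>Any choice of angle will do, since \<open>R\<close> takes the same value at angles with the same point on the
    circle.\<close>
  define r where "r = (\<lambda>(t, p). R (t, SOME \<theta>. circle_pt \<theta> = p))"
  have r: "r (t, circle_pt \<theta>) = R (t, \<theta>)" for t \<theta>
    unfolding r_def prod.case
    by (intro Req allI Feq) (rule someI[of "\<lambda>\<theta>'. circle_pt \<theta>' = circle_pt \<theta>" \<theta>], rule refl)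
  have strip: "(t, \<theta>) \<in> strip e" if "t \<in> {0..<e}" for t \<theta>
    using that by (auto simp: strip_def)
  have "r (t, p) > 0" if "t \<in> {0..<e}" "p \<in> unit_circle" for t p
  proof -
    have "(fst p)^2 + (snd p)^2 = 1" using that(2) by (simp add: norm_prod_def)
    then obtain \<theta> where "fst p = cos \<theta>" "snd p = sin \<theta>"
      using sincos_total_2pi_le by blast
    then have "p = circle_pt \<theta>" by (simp add: circle_pt_def prod_eq_iff)
    then show ?thesis using r[of t \<theta>] R[OF strip[OF that(1)], of \<theta>] by simp
  qed
  moreover have "C_on_collar (if s = 4 then 0 else quarter s) e r"
    unfolding C_on_collar_def C_on_def r
  proof (intro allI impI)
    fix k assume k: "enat k \<le> (if s = 4 then 0 else quarter s)"
    \<comment> \<open>The arithmetic behind the exponent: \<open>s div 4 \<le> s - 4\<close> holds from \<open>s = 5\<close> on and fails for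
      \<open>s = 4\<close>.\<close>
    have "enat (4 + k) \<le> s"
    proof (cases s)
      case (enat m)
      then show ?thesis using k assms(1)
        by (auto simp: quarter_def numeral_eq_enat zero_enat_def split: if_splits)
    qed simp
    then have "Cn_on k R ({0..<e} \<times> UNIV)"
      by (rule Cn_on_subset[OF RC]) (auto simp: strip_def)
    then show "Cn_on k (\<lambda>(t, \<theta>). R (t, \<theta>)) ({0..<e} \<times> UNIV)" by simp
  qed
  moreover have "r (0, circle_pt \<theta>) = cusp_r0 \<kappa>\<^sub>1 b\<^sub>2 c\<^sub>4 \<theta>" for \<theta>
    using R0[of \<theta>] by (simp add: r cusp_r0_def q_def)
  moreover have "let \<rho> = t * r (t, circle_pt \<theta>); p = (\<rho>^2 * cos \<theta>, \<rho> * sin \<theta>)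
      in p \<in> ball 0 1 \<and> f p = t^4" if "t \<in> {0..<e}" for t \<theta>
  proof -
    have "weighted_polar (t * R (t, \<theta>), \<theta>) \<in> ball 0 1"
      by (rule subsetD[OF weighted_polar_strip imageI]) (use R[OF strip[OF that]] in blast)
    then show ?thesis
      using R[OF strip[OF that]] by (simp add: Let_def r F_def weighted_polar_def)
  qed
  ultimately show ?thesis using e by (intro exI[of _ e] exI[of _ r] conjI ballI allI)
qed

end
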